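(* Let $N\ge2$, $k\ge1$, let $[a]$ be an $S_k$-orbit of $\mathbb{Z}_N^k$ with standard form $\hat a=((N-1)^{a_{N-1}},\dots,1^{a_1},0^{a_0})$, and let $[b]=[(1^m,0^{k-m})]$ with $0\le m\le k$. Then for every $S_k$-orbit $[c]$ of $\mathbb{Z}_N^k$: $M_{[a],[b]}^{(k)[c]}=1$ if the standard form of $[c]$ is $$\hat c=\left((N-1)^{a_{N-1}-m_{N-1}+m_{N-2}},\dots,1^{a_1-m_1+m_0},0^{a_0-m_0+m_{N-1}}\right)$$ for some integers $m_0,m_1,\dots,m_{N-1}$ with $\sum_{i=0}^{N-1}m_i=m$ and $0\le m_i\le a_i$ for $0\le i\le N-1$; and $M_{[a],[b]}^{(k)[c]}=0$ otherwise.
   Context: $S_k$ acts on $\mathbb{Z}_N^k$ ($\mathbb{Z}_N=\mathbb{Z}/N\mathbb{Z}$) by permuting coordinates; $[x]$ denotes the orbit of $x$. Each orbit $[x]$ has a unique representative in standard form $\hat x=((N-1)^{a_{N-1}},\dots,1^{a_1},0^{a_0})$, where exponents denote numbers of repetitions and $\sum_i a_i=k$. For orbits $[a],[b],[c]$ let $T([a],[b],[c])=\{(x,y,z)\in[a]\times[b]\times[c] : x+y=z\}$, with $S_k$ acting by $\sigma(x,y,z)=(\sigma x,\sigma y,\sigma z)$; $M_{[a],[b]}^{(k)[c]}$ is the number of $S_k$-orbits of $T([a],[b],[c])$. *)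

theory Defs
  imports Main "HOL-Combinatorics.List_Permutation"
begin

text \<open>
  The ring of integers modulo \<open>N\<close> is represented by its residues \<open>0, \<dots>, N - 1\<close> with
  addition modulo \<open>N\<close>, and a vector of length \<open>k\<close> over it by a list of length \<open>k\<close>.
\<close>

definition Zvecs :: "nat \<Rightarrow> nat \<Rightarrow> nat list set" where
  "Zvecs N k = {x. length x = k \<and> set x \<subseteq> {..<N}}"

definition Zadd :: "nat \<Rightarrow> nat list \<Rightarrow> nat list \<Rightarrow> nat list" where
  "Zadd N x y = map2 (\<lambda>i j. (i + j) mod N) x y"

text \<open>
  \<open>permute_list \<sigma> x\<close> has entry \<open>x ! \<sigma> i\<close> at position \<open>i\<close>.  The other convention
  (\<open>inv \<sigma>\<close> in place of \<open>\<sigma>\<close>) yields the same orbits, both below and for triples,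
  since \<open>\<sigma>\<close> ranges over the whole symmetric group.
\<close>

definition Sorbit :: "nat \<Rightarrow> nat list \<Rightarrow> nat list set" where
  "Sorbit k x = {permute_list \<sigma> x | \<sigma>. \<sigma> permutes {..<k}}"

definition Sorbits :: "nat \<Rightarrow> nat \<Rightarrow> nat list set set" where
  "Sorbits N k = Sorbit k ` Zvecs N k"

text \<open>The vector \<open>((N-1)^e(N-1), \<dots>, 1^e(1), 0^e(0))\<close>, exponents denoting repetition.\<close>

definition std_vec :: "nat \<Rightarrow> (nat \<Rightarrow> nat) \<Rightarrow> nat list" where
  "std_vec N e = concat (map (\<lambda>i. replicate (e i) i) (rev [0..<N]))"

text \<open>The standard form of the orbit \<open>C\<close> is the vector with exponents \<open>e\<close>.\<close>

definition has_std_form :: "nat \<Rightarrow> nat \<Rightarrow> nat list set \<Rightarrow> (nat \<Rightarrow> nat) \<Rightarrow> bool" where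
  "has_std_form N k C e \<longleftrightarrow> (\<Sum>i<N. e i) = k \<and> std_vec N e \<in> C"

definition T :: "nat \<Rightarrow> nat list set \<Rightarrow> nat list set \<Rightarrow> nat list set
    \<Rightarrow> (nat list \<times> nat list \<times> nat list) set" where
  "T N A B C = {(x, y, z). x \<in> A \<and> y \<in> B \<and> z \<in> C \<and> Zadd N x y = z}"

definition triple_orbit :: "nat \<Rightarrow> nat list \<times> nat list \<times> nat list
    \<Rightarrow> (nat list \<times> nat list \<times> nat list) set" where
  "triple_orbit k = (\<lambda>(x, y, z).
     {(permute_list \<sigma> x, permute_list \<sigma> y, permute_list \<sigma> z) | \<sigma>. \<sigma> permutes {..<k}})"

definition M :: "nat \<Rightarrow> nat \<Rightarrow> nat list set \<Rightarrow> nat list set \<Rightarrow> nat list set \<Rightarrow> nat" where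
  "M N k A B C = card (triple_orbit k ` T N A B C)"

lemma length_std_vec: "length (std_vec N e) = (\<Sum>i<N. e i)"
  by (induction N) (auto simp: std_vec_def)

lemma count_std_vec: "count (mset (std_vec N e)) v = (if v < N then e v else 0)"
  by (induction N) (auto simp: std_vec_def less_Suc_eq)

lemma Sorbit_eq_mset:
  assumes "length x = k"
  shows "Sorbit k x = {y. mset y = mset x}"
  using assms by (auto simp: Sorbit_def) (metis mset_eq_permutation)

text \<open>Every orbit has exactly one standard form, and it has only one exponent sequence.\<close>

lemma std_form_exists:
  assumes "C \<in> Sorbits N k"
  shows "\<exists>e. has_std_form N k C e"
proof -
  obtain x where x: "length x = k" "set x \<subseteq> {..<N}" "C = {y. mset y = mset x}"
    using assms by (auto simp: Sorbits_def Zvecs_def Sorbit_eq_mset)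
  have "mset (std_vec N (count (mset x))) = mset x"
    using x(2) by (intro multiset_eqI) (auto simp: count_std_vec count_eq_zero_iff not_less)
  moreover from this have "(\<Sum>i<N. count (mset x) i) = k"
    using x(1) by (metis length_std_vec mset_eq_length)
  ultimately show ?thesis
    using x(3) by (auto simp: has_std_form_def)
qed

lemma std_form_unique:
  assumes "C \<in> Sorbits N k" "has_std_form N k C e" "has_std_form N k C e'" "i < N"
  shows "e i = e' i"
proof -
  obtain x where "C = {y. mset y = mset x}"
    using assms(1) by (auto simp: Sorbits_def Zvecs_def Sorbit_eq_mset)
  then have "mset (std_vec N e) = mset (std_vec N e')"
    using assms by (simp add: has_std_form_def)
  then show ?thesis
    using assms(4) by (metis count_std_vec)
qed

end

theory Submission imports Defs
begin

text \<open>
  A triple \<open>(x, y, x + y)\<close> is a word in the pairs \<open>(x\<^sub>j, y\<^sub>j)\<close>, and the symmetric group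
  permutes the letters of this word.  Hence the orbit of the triple is determined by the multiset
  of these pairs (\<open>triple_orbit_eq_image\<close>).  When \<open>y\<close> has entries in \<open>{0, 1}\<close>, this multiset
  is in turn known from the content of \<open>x\<close> and the numbers \<open>\<mu> i\<close> of positions with entries
  \<open>(i, 1)\<close>, that is, of the entries \<open>i\<close> of \<open>x\<close> that adding \<open>y\<close> raises to \<open>i + 1\<close>.  They satisfy
  \<open>\<mu> i \<le> a i\<close> and add up to \<open>m\<close>, and \<open>x + y\<close> contains the residue \<open>i\<close> exactly
  \<open>a i - \<mu> i + \<mu> (i - 1)\<close> times, with indices modulo \<open>N\<close> (\<open>T_raised_counts\<close>).
  Conversely every such \<open>\<mu>\<close> comes from a triple (\<open>T_from_raised_counts\<close>).

  It remains to see that the orbit \<open>[c]\<close> leaves no choice for \<open>\<mu>\<close>.  It fixes the cyclic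
  differences \<open>\<mu> (i - 1) - \<mu> i\<close>, so \<open>\<mu>\<close> is known up to an additive constant, and the
  constant is fixed by the sum \<open>m\<close> (\<open>raised_counts_unique\<close>).  So there is exactly one orbit
  of triples if some \<open>\<mu>\<close> exists, and none otherwise.
\<close>

section \<open>Orbits and contents of vectors\<close>

lemma length_mem_orbit:
  assumes "C \<in> Sorbits N k" "z \<in> C"
  shows "length z = k"
  using assms by (auto simp: Sorbits_def Zvecs_def Sorbit_def)

lemma mem_orbit_iff_counts:
  assumes "C \<in> Sorbits N k" "has_std_form N k C e"
  shows "z \<in> C \<longleftrightarrow> set z \<subseteq> {..<N} \<and> (\<forall>i<N. count (mset z) i = e i)"
proof -
  obtain w where "C = {y. mset y = mset w}"
    using assms(1) by (auto simp: Sorbits_def Zvecs_def Sorbit_eq_mset)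
  then have C: "C = {y. mset y = mset (std_vec N e)}"
    using assms(2) by (simp add: has_std_form_def)
  have "mset z = mset (std_vec N e) \<longleftrightarrow> (\<forall>i. count (mset z) i = (if i < N then e i else 0))"
    by (simp add: multiset_eq_iff count_std_vec)
  also have "\<dots> \<longleftrightarrow> set z \<subseteq> {..<N} \<and> (\<forall>i<N. count (mset z) i = e i)"
    by (auto simp: subset_eq count_mset_0_iff not_less)
  finally show ?thesis
    by (simp add: C)
qed

lemma has_std_form_iff_counts:
  assumes "C \<in> Sorbits N k" "z \<in> C"
  shows "has_std_form N k C e \<longleftrightarrow> (\<forall>i<N. count (mset z) i = e i)"
proof -
  obtain e' where e': "has_std_form N k C e'"
    using std_form_exists[OF assms(1)] by blast
  then have z: "\<forall>i<N. count (mset z) i = e' i"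
    using mem_orbit_iff_counts[OF assms(1)] assms(2) by blast
  have "has_std_form N k C e" if "\<forall>i<N. e' i = e i"
  proof -
    have "std_vec N e = std_vec N e'"
      unfolding std_vec_def using that by (intro arg_cong[of _ _ concat] map_cong) auto
    moreover have "(\<Sum>i<N. e i) = (\<Sum>i<N. e' i)"
      using that by simp
    ultimately show ?thesis
      using e' by (simp add: has_std_form_def)
  qed
  then show ?thesis
    using z std_form_unique[OF assms(1) e'] by auto
qed

lemma mem_ones_orbit_iff:
  assumes "m \<le> k"
  shows "y \<in> Sorbit k (replicate m 1 @ replicate (k - m) 0) \<longleftrightarrow>
    length y = k \<and> set y \<subseteq> {0, 1} \<and> count (mset y) 1 = m" (is "_ \<longleftrightarrow> ?R")
proof -
  let ?w = "replicate m 1 @ replicate (k - m) (0::nat)"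
  have orbit: "y \<in> Sorbit k ?w \<longleftrightarrow> mset y = mset ?w"
    using assms by (subst Sorbit_eq_mset) auto
  have "?R" if "mset y = mset ?w"
  proof -
    have "length y = k" using mset_eq_length[OF that] assms by simp
    moreover have "set y \<subseteq> {0, 1}" using mset_eq_setD[OF that] by (auto split: if_splits)
    ultimately show ?thesis using that by simp
  qed
  moreover have "mset y = mset ?w" if "?R"
  proof -
    have two: "count (mset v) 0 + count (mset v) 1 = length v" if "set v \<subseteq> {0, 1}"
      for v :: "nat list"
      using that by (induction v) auto
    have "count (mset y) i = count (mset ?w) i" for i
    proof (cases "i \<in> {0, 1}")
      case True
      then show ?thesis using two[of y] \<open>?R\<close> by auto
    next
      case False
      then have "i \<notin> set y" using \<open>?R\<close> by blast
      then have "count (mset y) i = 0" by (simp add: count_mset_0_iff)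
      then show ?thesis using False by simp
    qed
    then show ?thesis by (rule multiset_eqI)
  qed
  ultimately show ?thesis using orbit by blast
qed

section \<open>Triples as words in pairs\<close>

text \<open>
  A simultaneous permutation of \<open>x\<close>, \<open>y\<close> and \<open>x + y\<close> is a permutation of the word of pairs
  \<open>zip x y\<close>, and the permutations of a word are the words with the same multiset of letters.
  The right-hand side therefore depends on \<open>mset (zip x y)\<close> only.
\<close>

lemma triple_orbit_eq_image:
  assumes "length x = k" "length y = k"
  shows "triple_orbit k (x, y, Zadd N x y) =
    (\<lambda>w. (map fst w, map snd w, map (\<lambda>(i, j). (i + j) mod N) w)) `
      {w. mset w = mset (zip x y)}"
    (is "_ = ?f ` _")
proof -
  have perm: "?f (permute_list \<sigma> (zip x y)) =
      (permute_list \<sigma> x, permute_list \<sigma> y, permute_list \<sigma> (Zadd N x y))"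
    if "\<sigma> permutes {..<k}" for \<sigma>
  proof -
    have s: "\<sigma> permutes {..<length (zip x y)}"
      using that assms by simp
    show ?thesis
      using assms by (simp add: permute_list_map[OF s, symmetric] Zadd_def)
  qed
  have "(mset w = mset (zip x y)) = (\<exists>\<sigma>. \<sigma> permutes {..<k} \<and> w = permute_list \<sigma> (zip x y))" for w
  proof
    assume "mset w = mset (zip x y)"
    then obtain \<sigma> where "\<sigma> permutes {..<length (zip x y)}" "permute_list \<sigma> (zip x y) = w"
      by (rule mset_eq_permutation)
    then show "\<exists>\<sigma>. \<sigma> permutes {..<k} \<and> w = permute_list \<sigma> (zip x y)"
      using assms by auto
  next
    assume "\<exists>\<sigma>. \<sigma> permutes {..<k} \<and> w = permute_list \<sigma> (zip x y)"
    then show "mset w = mset (zip x y)"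
      using assms by (auto intro!: mset_permute_list)
  qed
  then have "{w. mset w = mset (zip x y)} = {permute_list \<sigma> (zip x y) | \<sigma>. \<sigma> permutes {..<k}}"
    by blast
  then have "?f ` {w. mset w = mset (zip x y)} =
      {?f (permute_list \<sigma> (zip x y)) | \<sigma>. \<sigma> permutes {..<k}}"
    by (simp only: setcompr_eq_image image_image)
  also have "\<dots> = triple_orbit k (x, y, Zadd N x y)"
    unfolding triple_orbit_def prod.case setcompr_eq_image
    by (intro image_cong refl perm) simp
  finally show ?thesis ..
qed

lemma count_fst_binary:
  assumes "length x = length y" "set y \<subseteq> {0, 1 :: nat}"
  shows "count (mset x) i = count (mset (zip x y)) (i, 0) + count (mset (zip x y)) (i, 1)"
  using assms by (induction x y rule: list_induct2) auto

lemma sum_count_raised: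
  fixes x y :: "nat list"
  assumes "length x = length y" "set x \<subseteq> {..<N}"
  shows "(\<Sum>i<N. count (mset (zip x y)) (i, j)) = count (mset y) j"
  using assms
proof (induction x y rule: list_induct2)
  case (Cons u x v y)
  have "count (mset (zip (u # x) (v # y))) (i, j) =
      count (mset (zip x y)) (i, j) + (if i = u then if v = j then 1 else 0 else 0)" for i
    by auto
  then show ?case
    using Cons by (simp add: sum.distrib)
qed simp

text \<open>
  An entry \<open>i\<close> of \<open>x + y\<close> arises either from an unraised \<open>i\<close> or from a raised \<open>i - 1\<close>,
  where a raised \<open>N - 1\<close> becomes \<open>0\<close>.
\<close>

lemma count_Zadd_binary:
  assumes "length x = length y" "set x \<subseteq> {..<N}" "set y \<subseteq> {0, 1}" "i < N"
  shows "count (mset (Zadd N x y)) i =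
    count (mset (zip x y)) (i, 0) + count (mset (zip x y)) (if i = 0 then N - 1 else i - 1, 1)"
  using assms
proof (induction x y rule: list_induct2)
  case (Cons u x v y)
  have "(u + 1) mod N = i \<longleftrightarrow> u = (if i = 0 then N - 1 else i - 1)"
    using Cons.prems by (cases "u + 1 = N") auto
  then show ?case
    using Cons by (auto simp: Zadd_def)
qed (simp add: Zadd_def)

section \<open>Numbers of raised entries\<close>

text \<open>
  The content obtained from the content \<open>a\<close> when \<open>\<mu> i\<close> of the entries \<open>i\<close> are raised
  to \<open>i + 1\<close>, cyclically, for each residue \<open>i\<close>.
\<close>

definition raise_content :: "nat \<Rightarrow> (nat \<Rightarrow> nat) \<Rightarrow> (nat \<Rightarrow> nat) \<Rightarrow> nat \<Rightarrow> nat" where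
  "raise_content N a \<mu> = (\<lambda>i. a i - \<mu> i + \<mu> (if i = 0 then N - 1 else i - 1))"

text \<open>
  The data in the theorem's criterion can be read off from any triple: \<open>\<mu> i\<close> counts the
  positions at which \<open>x\<close> and \<open>y\<close> have the entries \<open>i\<close> and \<open>1\<close>.
\<close>

lemma T_raised_counts:
  assumes "A \<in> Sorbits N k" "has_std_form N k A a" "C \<in> Sorbits N k" "m \<le> k"
    and "(x, y, z) \<in> T N A (Sorbit k (replicate m 1 @ replicate (k - m) 0)) C"
  defines "\<mu> \<equiv> \<lambda>i. count (mset (zip x y)) (i, 1)"
  shows "length x = k" "length y = k" "set x \<subseteq> {..<N}" "set y \<subseteq> {0, 1}" "z = Zadd N x y"
    and "(\<Sum>i<N. \<mu> i) = m" "\<forall>i<N. \<mu> i \<le> a i" "\<forall>i<N. count (mset (zip x y)) (i, 0) = a i - \<mu> i"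
    and "has_std_form N k C (raise_content N a \<mu>)"
proof -
  have x: "x \<in> A" and z: "z \<in> C" and y: "length y = k" "set y \<subseteq> {0, 1}" "count (mset y) 1 = m"
    and zadd: "z = Zadd N x y"
    using assms(5) mem_ones_orbit_iff[OF assms(4)] by (auto simp: T_def)
  show len: "length x = k"
    using length_mem_orbit[OF assms(1) x] .
  show "length y = k" "set y \<subseteq> {0, 1}" "z = Zadd N x y"
    by fact+
  show setx: "set x \<subseteq> {..<N}"
    using mem_orbit_iff_counts[OF assms(1,2)] x by blast
  have "count (mset x) i = a i" if "i < N" for i
    using mem_orbit_iff_counts[OF assms(1,2)] x that by blast
  then have split: "a i = count (mset (zip x y)) (i, 0) + \<mu> i" if "i < N" for i
    using count_fst_binary[of x y i] len y that by (simp add: \<mu>_def)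
  show "(\<Sum>i<N. \<mu> i) = m"
    using sum_count_raised[of x y N 1] len y setx by (simp add: \<mu>_def)
  show "\<forall>i<N. \<mu> i \<le> a i" and zero: "\<forall>i<N. count (mset (zip x y)) (i, 0) = a i - \<mu> i"
    using split by auto
  show "has_std_form N k C (raise_content N a \<mu>)"
    using count_Zadd_binary[of x y N] len y setx zero
    by (simp add: has_std_form_iff_counts[OF assms(3) z] zadd raise_content_def \<mu>_def)
qed

text \<open>
  Conversely, take a word with \<open>\<mu> i\<close> letters \<open>(i, 1)\<close> and \<open>a i - \<mu> i\<close> letters \<open>(i, 0)\<close>
  for each residue \<open>i\<close>; its two coordinates are \<open>x\<close> and \<open>y\<close>.
\<close>

lemma T_from_raised_counts:
  assumes "A \<in> Sorbits N k" "has_std_form N k A a" "C \<in> Sorbits N k" "m \<le> k"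
    and "(\<Sum>i<N. \<mu> i) = m" "\<forall>i<N. \<mu> i \<le> a i" "has_std_form N k C (raise_content N a \<mu>)"
  shows "T N A (Sorbit k (replicate m 1 @ replicate (k - m) 0)) C \<noteq> {}"
proof -
  obtain w where w: "mset w =
      (\<Sum>i<N. replicate_mset (\<mu> i) (i, 1 :: nat) + replicate_mset (a i - \<mu> i) (i, 0))"
    using ex_mset by blast
  define x y where "x = map fst w" and "y = map snd w"
  have zip: "zip x y = w"
    by (simp add: x_def y_def zip_map_fst_snd)
  have "set_mset (mset w) \<subseteq> {..<N} \<times> {0, 1}"
    unfolding w by (auto simp: set_mset_sum split: if_splits)
  then have setw: "set w \<subseteq> {..<N} \<times> {0, 1}"
    by simp
  then have setx: "set x \<subseteq> {..<N}" and sety: "set y \<subseteq> {0, 1}"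
    by (auto simp: x_def y_def)
  have len: "length x = length y"
    by (simp add: x_def y_def)
  have one: "count (mset (zip x y)) (i, 1) = \<mu> i" if "i < N" for i
  proof -
    have "count (mset w) (i, 1) = (\<Sum>j<N. if j = i then \<mu> j else 0)"
      unfolding w count_sum by (intro sum.cong) auto
    then show ?thesis using that by (simp add: zip)
  qed
  have zero: "count (mset (zip x y)) (i, 0) = a i - \<mu> i" if "i < N" for i
  proof -
    have "count (mset w) (i, 0) = (\<Sum>j<N. if j = i then a j - \<mu> j else 0)"
      unfolding w count_sum by (intro sum.cong) auto
    then show ?thesis using that by (simp add: zip)
  qed
  have "count (mset x) i = a i" if "i < N" for i
    using count_fst_binary[OF len sety, of i] one[OF that] zero[OF that] assms(6) that by simp
  then have xA: "x \<in> A"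
    using mem_orbit_iff_counts[OF assms(1,2)] setx by blast
  have "length y = k"
    using length_mem_orbit[OF assms(1) xA] len by simp
  moreover have "count (mset y) 1 = m"
    using sum_count_raised[OF len setx, of 1] one assms(5) by simp
  ultimately have yB: "y \<in> Sorbit k (replicate m 1 @ replicate (k - m) 0)"
    using mem_ones_orbit_iff[OF assms(4)] sety by blast
  have "count (mset (Zadd N x y)) i = raise_content N a \<mu> i" if "i < N" for i
    using count_Zadd_binary[OF len setx sety that] one zero that
    by (auto simp: raise_content_def)
  moreover have "set (Zadd N x y) \<subseteq> {..<N}"
    using setx by (force simp: Zadd_def dest: set_zip_leftD)
  ultimately have "Zadd N x y \<in> C"
    using mem_orbit_iff_counts[OF assms(3,7)] by blast
  then show ?thesis
    using xA yB by (auto simp: T_def)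
qed

section \<open>Uniqueness and the orbit count\<close>

text \<open>
  Equal cyclic differences mean that \<open>\<mu> i - \<nu> i\<close> does not depend on \<open>i\<close>.  As both functions
  have the same sum, \<open>N\<close> times this constant vanishes.
\<close>

lemma raised_counts_unique:
  assumes "\<forall>i<N. \<mu> i \<le> a i" "\<forall>i<N. \<nu> i \<le> a i" "(\<Sum>i<N. \<mu> i) = (\<Sum>i<N. \<nu> i)"
    and "\<forall>i<N. raise_content N a \<mu> i = raise_content N a \<nu> i"
    and "i < N"
  shows "\<mu> i = \<nu> i"
proof -
  have const: "\<mu> j + \<nu> 0 = \<nu> j + \<mu> 0" if "j < N" for j
    using that
  proof (induction j)
    case (Suc j)
    have "a (Suc j) - \<mu> (Suc j) + \<mu> j = a (Suc j) - \<nu> (Suc j) + \<nu> j"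
      using assms(4) Suc.prems by (auto simp: raise_content_def)
    moreover have "\<mu> (Suc j) \<le> a (Suc j)" "\<nu> (Suc j) \<le> a (Suc j)"
      using assms(1,2) Suc.prems by blast+
    ultimately show ?case
      using Suc by simp
  qed simp
  have "(\<Sum>j<N. \<mu> j + \<nu> 0) = (\<Sum>j<N. \<nu> j + \<mu> 0)"
    using const by (intro sum.cong) auto
  then have "N * \<nu> 0 = N * \<mu> 0"
    using assms(3) by (simp add: sum.distrib)
  then show ?thesis
    using const[OF assms(5)] assms(5) by simp
qed

lemma triple_orbit_T_unique:
  assumes "A \<in> Sorbits N k" "has_std_form N k A a" "C \<in> Sorbits N k" "m \<le> k"
    and "t \<in> T N A (Sorbit k (replicate m 1 @ replicate (k - m) 0)) C"
    and "t' \<in> T N A (Sorbit k (replicate m 1 @ replicate (k - m) 0)) C"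
  shows "triple_orbit k t = triple_orbit k t'"
proof -
  obtain x y z x' y' z' where t: "t = (x, y, z)" "t' = (x', y', z')"
    by (metis prod_cases3)
  note r = T_raised_counts[OF assms(1-4) assms(5)[unfolded t]]
  note r' = T_raised_counts[OF assms(1-4) assms(6)[unfolded t]]
  have "\<forall>i<N. raise_content N a (\<lambda>i. count (mset (zip x y)) (i, 1)) i =
      raise_content N a (\<lambda>i. count (mset (zip x' y')) (i, 1)) i"
    using std_form_unique[OF assms(3) r(9) r'(9)] by blast
  then have one: "count (mset (zip x y)) (i, 1) = count (mset (zip x' y')) (i, 1)" if "i < N" for i
    using raised_counts_unique[OF r(7) r'(7)] r(6) r'(6) that by simp
  then have zero: "count (mset (zip x y)) (i, 0) = count (mset (zip x' y')) (i, 0)" if "i < N" for i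
    using r(8) r'(8) that by simp
  have "count (mset (zip x y)) p = count (mset (zip x' y')) p" for p
  proof (cases "p \<in> {..<N} \<times> {0, 1}")
    case True
    then show ?thesis using one zero by auto
  next
    case False
    then have "p \<notin> set (zip x y)" "p \<notin> set (zip x' y')"
      using r(3,4) r'(3,4) by (cases p; auto dest: set_zip_leftD set_zip_rightD)+
    then show ?thesis by (metis count_mset_0_iff)
  qed
  then have "mset (zip x y) = mset (zip x' y')"
    by (rule multiset_eqI)
  then show ?thesis
    unfolding t r(5) r'(5)
    by (simp only: triple_orbit_eq_image[OF r(1,2)] triple_orbit_eq_image[OF r'(1,2)])
qed

theorem corollary3p0p10:
  fixes N k m :: nat and a :: "nat \<Rightarrow> nat" and A C :: "nat list set"
  assumes "N \<ge> 2" and "k \<ge> 1"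
    and "A \<in> Sorbits N k" and "has_std_form N k A a"
    and "m \<le> k"
    and "C \<in> Sorbits N k"
  shows "M N k A (Sorbit k (replicate m 1 @ replicate (k - m) 0)) C =
    (if \<exists>\<mu> :: nat \<Rightarrow> nat. (\<Sum>i<N. \<mu> i) = m \<and> (\<forall>i<N. \<mu> i \<le> a i) \<and>
          has_std_form N k C (\<lambda>i. a i - \<mu> i + \<mu> (if i = 0 then N - 1 else i - 1))
     then 1 else 0)"
proof -
  let ?T = "T N A (Sorbit k (replicate m 1 @ replicate (k - m) 0)) C"
  let ?P = "\<exists>\<mu> :: nat \<Rightarrow> nat. (\<Sum>i<N. \<mu> i) = m \<and> (\<forall>i<N. \<mu> i \<le> a i) \<and>
      has_std_form N k C (raise_content N a \<mu>)"
  have nonempty: "?T \<noteq> {} \<longleftrightarrow> ?P"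
  proof
    assume "?T \<noteq> {}"
    then obtain x y z where "(x, y, z) \<in> ?T"
      by auto
    from T_raised_counts(6,7,9)[OF assms(3,4,6,5) this] show ?P
      by blast
  next
    assume ?P
    then show "?T \<noteq> {}"
      using T_from_raised_counts[OF assms(3,4,6,5)] by blast
  qed
  have "card (triple_orbit k ` ?T) = 1" if ne: "?T \<noteq> {}"
  proof -
    obtain t where t: "t \<in> ?T"
      using ne by blast
    have "triple_orbit k ` ?T = {triple_orbit k t}"
      using triple_orbit_T_unique[OF assms(3,4,6,5) _ t] t by blast
    then show ?thesis by simp
  qed
  then have "M N k A (Sorbit k (replicate m 1 @ replicate (k - m) 0)) C = (if ?P then 1 else 0)"
    using nonempty by (auto simp: M_def)
  then show ?thesis
    by (simp only: raise_content_def)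
qed

end
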